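(* Let $\mathfrak{a}(\mathfrak{g};\kappa,\lambda,s)$ and $\mathfrak{a}(\mathfrak{g}';\kappa',\lambda',s')$ be Lie affgebras over $\mathbb{F}$. A function $\varphi:\mathfrak{a}(\mathfrak{g};\kappa,\lambda,s)\to\mathfrak{a}(\mathfrak{g}';\kappa',\lambda',s')$ is a homomorphism of Lie affgebras if and only if there exist a Lie algebra homomorphism $\psi:\mathfrak{g}\to\mathfrak{g}'$ and $q'\in\mathfrak{g}'$ such that $\varphi(a)=\psi(a)+q'$ for all $a\in\mathfrak{g}$ and $$\psi\kappa=\kappa'\psi,\qquad \psi\lambda=(\mathrm{ad}_{q'}+\lambda')\psi,\qquad \psi(s)=s'-q'+\kappa'(q').$$
   Context: $\mathbb{F}$ is a field of characteristic different from 2. $\mathrm{ad}_a(b)=[a,b]$. For a Lie algebra $\mathfrak{g}$ over $\mathbb{F}$, linear endomorphisms $\kappa,\lambda$ of $\mathfrak{g}$ satisfying $\lambda([a,b])=[\lambda(a),b]-[a,\kappa(b)]+[a,\lambda(b)]$ for all $a,b\in\mathfrak{g}$, and $s\in\mathfrak{g}$, the symbol $\mathfrak{a}(\mathfrak{g};\kappa,\lambda,s)$ denotes the Lie affgebra which is the vector space $\mathfrak{g}$ viewed as an affine space ($\langle a,b,c\rangle=a-b+c$, $\alpha\triangleright_a b=(1-\alpha)a+\alpha b$) with the affine Lie bracket $\{a,b\}=[a,b]+\kappa(a)+\lambda(b-a)+s$. A homomorphism of Lie affgebras is an affine map (preserving $\langle-,-,-\rangle$ and satisfying $f(\alpha\triangleright_a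 b)=\alpha\triangleright_{f(a)}f(b)$; between vector spaces this means linear plus constant) such that $f(\{a,b\})=\{f(a),f(b)\}$ for all $a,b$. *)

theory Defs
  imports "HOL-Computational_Algebra.Computational_Algebra"
begin

locale lie_algebra = vector_space scale
  for scale :: "'f::field \<Rightarrow> 'a::ab_group_add \<Rightarrow> 'a" +
  fixes bracket :: "'a \<Rightarrow> 'a \<Rightarrow> 'a"
  assumes linear_bracket_left: "Vector_Spaces.linear scale scale (\<lambda>a. bracket a b)"
    and linear_bracket_right: "Vector_Spaces.linear scale scale (\<lambda>b. bracket a b)"
    and bracket_self: "bracket a a = 0"
    and jacobi: "bracket a (bracket b c) + bracket b (bracket c a) + bracket c (bracket a b) = 0"

definition lie_algebra_hom ::
  "('f::field \<Rightarrow> 'a::ab_group_add \<Rightarrow> 'a) \<Rightarrow> ('a \<Rightarrow> 'a \<Rightarrow> 'a) \<Rightarrow>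
   ('f \<Rightarrow> 'b::ab_group_add \<Rightarrow> 'b) \<Rightarrow> ('b \<Rightarrow> 'b \<Rightarrow> 'b) \<Rightarrow> ('a \<Rightarrow> 'b) \<Rightarrow> bool" where
  "lie_algebra_hom scale bracket scale' bracket' \<psi> \<longleftrightarrow>
     Vector_Spaces.linear scale scale' \<psi> \<and>
     (\<forall>a b. \<psi> (bracket a b) = bracket' (\<psi> a) (\<psi> b))"

definition ad :: "('a \<Rightarrow> 'a \<Rightarrow> 'a) \<Rightarrow> 'a \<Rightarrow> 'a \<Rightarrow> 'a" where
  "ad bracket a = (\<lambda>b. bracket a b)"

text \<open>
  The operations of an affine space with a bracket:
  \<open>heap A a b c\<close> is \<open>\<langle>a, b, c\<rangle>\<close>, \<open>act A \<alpha> a b\<close> is the action of the scalar \<open>\<alpha>\<close> on \<open>b\<close>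
  based at \<open>a\<close>, and \<open>aff_bracket A a b\<close> is \<open>{a, b}\<close>. The record carries no axioms.
\<close>

record ('f, 'a) affgebra =
  heap :: "'a \<Rightarrow> 'a \<Rightarrow> 'a \<Rightarrow> 'a"
  act :: "'f \<Rightarrow> 'a \<Rightarrow> 'a \<Rightarrow> 'a"
  aff_bracket :: "'a \<Rightarrow> 'a \<Rightarrow> 'a"

definition affine_map ::
  "('f, 'a) affgebra \<Rightarrow> ('f, 'b) affgebra \<Rightarrow> ('a \<Rightarrow> 'b) \<Rightarrow> bool" where
  "affine_map A B f \<longleftrightarrow>
     (\<forall>a b c. f (heap A a b c) = heap B (f a) (f b) (f c)) \<and>
     (\<forall>\<alpha> a b. f (act A \<alpha> a b) = act B \<alpha> (f a) (f b))"

definition lie_affgebra_hom ::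
  "('f, 'a) affgebra \<Rightarrow> ('f, 'b) affgebra \<Rightarrow> ('a \<Rightarrow> 'b) \<Rightarrow> bool" where
  "lie_affgebra_hom A B f \<longleftrightarrow>
     affine_map A B f \<and>
     (\<forall>a b. f (aff_bracket A a b) = aff_bracket B (f a) (f b))"

definition lie_affgebra_of ::
  "('f::field \<Rightarrow> 'a::ab_group_add \<Rightarrow> 'a) \<Rightarrow> ('a \<Rightarrow> 'a \<Rightarrow> 'a) \<Rightarrow>
   ('a \<Rightarrow> 'a) \<Rightarrow> ('a \<Rightarrow> 'a) \<Rightarrow> 'a \<Rightarrow> ('f, 'a) affgebra" where
  "lie_affgebra_of scale bracket \<kappa> \<Lambda> s =
     \<lparr> heap = (\<lambda>a b c. a - b + c),
       act = (\<lambda>\<alpha> a b. scale (1 - \<alpha>) a + scale \<alpha> b),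
       aff_bracket = (\<lambda>a b. bracket a b + \<kappa> a + \<Lambda> (b - a) + s) \<rparr>"

text \<open>
  The conditions on \<open>\<kappa>\<close> and \<open>\<Lambda>\<close> under which \<open>lie_affgebra_of\<close> yields a Lie affgebra;
  the translation element \<open>s\<close> is unconstrained.
\<close>

locale lie_affgebra_data = lie_algebra scale bracket
  for scale :: "'f::field \<Rightarrow> 'a::ab_group_add \<Rightarrow> 'a"
    and bracket :: "'a \<Rightarrow> 'a \<Rightarrow> 'a" +
  fixes \<kappa> :: "'a \<Rightarrow> 'a" and \<Lambda> :: "'a \<Rightarrow> 'a"
  assumes linear_kappa: "Vector_Spaces.linear scale scale \<kappa>"
    and linear_lambda: "Vector_Spaces.linear scale scale \<Lambda>"
    and compat: "\<Lambda> (bracket a b) = bracket (\<Lambda> a) b - bracket a (\<kappa> b) + bracket a (\<Lambda> b)"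
begin

lemma aff_bracket_antisymmetric:
  fixes a b s :: 'a
  defines "A \<equiv> lie_affgebra_of scale bracket \<kappa> \<Lambda> s"
  shows "heap A (aff_bracket A a b) (aff_bracket A a a) (aff_bracket A b a) = aff_bracket A b b"
proof -
  interpret l: Vector_Spaces.linear scale scale \<Lambda> by (rule linear_lambda)
  interpret L: Vector_Spaces.linear scale scale "\<lambda>x. bracket x u" for u by (rule linear_bracket_left)
  interpret R: Vector_Spaces.linear scale scale "\<lambda>x. bracket u x" for u by (rule linear_bracket_right)
  have "bracket a b + bracket b a = 0"
    using bracket_self[of "a + b"] by (simp only: L.add R.add) (simp add: bracket_self add.commute)
  then show ?thesis
    by (simp add: A_def lie_affgebra_of_def bracket_self l.diff l.zero algebra_simps)
qed

lemma aff_bracket_jacobi: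
  fixes a b c s :: 'a
  defines "A \<equiv> lie_affgebra_of scale bracket \<kappa> \<Lambda> s"
  defines "br \<equiv> aff_bracket A"
  shows "heap A (heap A (br a (br b c)) (br a (br a a)) (br b (br c a)))
           (br b (br b b)) (br c (br a b)) = br c (br c c)"
proof -
  interpret k: Vector_Spaces.linear scale scale \<kappa> by (rule linear_kappa)
  interpret l: Vector_Spaces.linear scale scale \<Lambda> by (rule linear_lambda)
  interpret L: Vector_Spaces.linear scale scale "\<lambda>x. bracket x u" for u by (rule linear_bracket_left)
  interpret R: Vector_Spaces.linear scale scale "\<lambda>x. bracket u x" for u by (rule linear_bracket_right)
  have "bracket x y + bracket y x = 0" for x y
    using bracket_self[of "x + y"] by (simp only: L.add R.add) (simp add: bracket_self add.commute)
  then have anti: "bracket x y = - bracket y x" for x y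
    by (simp add: eq_neg_iff_add_eq_0)
  have kself: "bracket x (\<kappa> x) = 0" for x
    using compat[of x x] anti[of "\<Lambda> x" x] by (simp add: bracket_self l.zero)
  have J: "bracket a (bracket b c) = - bracket b (bracket c a) - bracket c (bracket a b)"
    using jacobi[of a b c] by (simp add: algebra_simps eq_neg_iff_add_eq_0)
  have C: "bracket x (\<Lambda> y) = \<Lambda> (bracket x y) - bracket (\<Lambda> x) y + bracket x (\<kappa> y)" for x y
    using compat[of x y] by (simp add: algebra_simps)
  have "br x (br y z) - br x (br x x) =
      bracket x (bracket y z) + bracket x (\<kappa> y) + bracket x (\<Lambda> z) - bracket x (\<Lambda> y)
      + \<Lambda> (bracket y z) + \<Lambda> (\<kappa> y) - \<Lambda> (\<kappa> x) + \<Lambda> (\<Lambda> z) - \<Lambda> (\<Lambda> y)" for x y z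
    by (simp add: br_def A_def lie_affgebra_of_def bracket_self kself l.add l.diff l.zero R.add R.diff
        R.zero algebra_simps)
  note D = this
  have "br a (br b c) - br a (br a a) + (br b (br c a) - br b (br b b))
        + (br c (br a b) - br c (br c c)) = 0"
    unfolding D J C[of a b] C[of b c] C[of c a] using anti[of "\<Lambda> a" b] anti[of "\<Lambda> b" c] anti[of "\<Lambda> c" a]
    by (simp add: anti[of c a] anti[of a b] anti[of b c] l.neg algebra_simps)
  then show ?thesis
    by (simp add: A_def lie_affgebra_of_def algebra_simps)
qed

end

end

theory Submission
  imports Defs
begin

text \<open>
  An affine map between vector spaces is a linear map \<open>\<psi>\<close> followed by a translation by
  \<open>q' = \<phi> 0\<close> (lemma \<open>affine_map_iff_linear_plus_const\<close>). So only the bracket condition on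
  \<open>\<phi> = \<psi> + q'\<close> is at issue. Since the Lie bracket is alternating,
  \<open>[\<psi> a + q', \<psi> b + q'] = [\<psi> a, \<psi> b] + [q', \<psi> (b - a)]\<close>, so that moving the base point of
  the target to \<open>q'\<close> leaves the bracket and \<open>\<kappa>'\<close> alone, replaces \<open>\<Lambda>'\<close> by \<open>ad q' + \<Lambda>'\<close>
  and turns the constant \<open>s'\<close> into \<open>s' + \<kappa>' q'\<close>
  (lemma \<open>aff_bracket_translate\<close>). Both sides of the bracket condition are now of the form
  bilinear term in \<open>(a, b)\<close> + linear term in \<open>a\<close> + linear term in \<open>b - a\<close> + constant,
  and the four stated conditions say that these terms agree one by one. They can be separated by
  evaluation: \<open>a = b = 0\<close> isolates the constant, \<open>a = b\<close> the linear term in \<open>a\<close>,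
  \<open>a = 0\<close> the linear term in \<open>b - a\<close>, and what is left is the bilinear term.
\<close>

context lie_algebra
begin

lemma bracket_anticommute: "bracket a b = - bracket b a"
proof -
  interpret L: Vector_Spaces.linear scale scale "\<lambda>x. bracket x u" for u by (rule linear_bracket_left)
  interpret R: Vector_Spaces.linear scale scale "\<lambda>x. bracket u x" for u by (rule linear_bracket_right)
  have "bracket a b + bracket b a = 0"
    using bracket_self[of "a + b"] by (simp only: L.add R.add) (simp add: bracket_self add.commute)
  then show ?thesis
    by (simp add: eq_neg_iff_add_eq_0)
qed

lemma bracket_translate:
  "bracket (a + q) (b + q) = bracket a b + bracket q (b - a)"
proof -
  interpret L: Vector_Spaces.linear scale scale "\<lambda>x. bracket x u" for u by (rule linear_bracket_left)
  interpret R: Vector_Spaces.linear scale scale "\<lambda>x. bracket u x" for u by (rule linear_bracket_right)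
  show ?thesis
    by (simp add: L.add R.add R.diff bracket_self bracket_anticommute[of a q])
qed

end

lemma (in lie_affgebra_data) aff_bracket_translate:
  "aff_bracket (lie_affgebra_of scale bracket \<kappa> \<Lambda> s) (a + q) (b + q) =
     bracket a b + \<kappa> a + (ad bracket q (b - a) + \<Lambda> (b - a)) + (s + \<kappa> q)"
proof -
  interpret k: Vector_Spaces.linear scale scale \<kappa> by (rule linear_kappa)
  show ?thesis
    by (simp add: lie_affgebra_of_def ad_def bracket_translate k.add add_ac)
qed

text \<open>
  Addition and scalar multiplication are the affine operations based at \<open>0\<close>:
  \<open>a + b = \<langle>a, 0, b\<rangle>\<close>, and \<open>\<alpha> b\<close> is the action of \<open>\<alpha>\<close> on \<open>b\<close> based at \<open>0\<close>. An affine
  map therefore becomes linear once its value at \<open>0\<close> is subtracted.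
\<close>

lemma affine_map_iff_linear_plus_const:
  fixes scale :: "'f::field \<Rightarrow> 'a::ab_group_add \<Rightarrow> 'a"
    and scale' :: "'f \<Rightarrow> 'b::ab_group_add \<Rightarrow> 'b"
  assumes "vector_space scale" and "vector_space scale'"
  shows "affine_map (lie_affgebra_of scale bracket \<kappa> \<Lambda> s)
           (lie_affgebra_of scale' bracket' \<kappa>' \<Lambda>' s') \<phi> \<longleftrightarrow>
         (\<exists>\<psi> q'. Vector_Spaces.linear scale scale' \<psi> \<and> (\<forall>a. \<phi> a = \<psi> a + q'))"
    (is "?affine \<longleftrightarrow> ?linear")
proof -
  interpret V: vector_space scale by fact
  interpret V': vector_space scale' by fact
  show ?thesis
  proof
    assume ?affine
    then have heap: "\<phi> (a - b + c) = \<phi> a - \<phi> b + \<phi> c"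
      and act: "\<phi> (scale (1 - \<alpha>) a + scale \<alpha> b) = scale' (1 - \<alpha>) (\<phi> a) + scale' \<alpha> (\<phi> b)"
      for \<alpha> a b c
      by (simp_all add: affine_map_def lie_affgebra_of_def)
    have "Vector_Spaces.linear scale scale' (\<lambda>a. \<phi> a - \<phi> 0)"
    proof (intro Vector_Spaces.linear.intro module_hom.intro module_hom_axioms.intro
        V.module_axioms V'.module_axioms V.vector_space_axioms V'.vector_space_axioms)
      show "\<phi> (a + b) - \<phi> 0 = (\<phi> a - \<phi> 0) + (\<phi> b - \<phi> 0)" for a b
        using heap[of a 0 b] by simp
      show "\<phi> (scale \<alpha> b) - \<phi> 0 = scale' \<alpha> (\<phi> b - \<phi> 0)" for \<alpha> b
        using act[of \<alpha> 0 b]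
        by (simp add: V'.scale_left_diff_distrib V'.scale_right_diff_distrib)
    qed
    then show ?linear
      by (intro exI[of _ "\<lambda>a. \<phi> a - \<phi> 0"] exI[of _ "\<phi> 0"]) simp
  next
    assume ?linear
    then obtain \<psi> q' where lin: "Vector_Spaces.linear scale scale' \<psi>"
      and \<phi>: "\<And>a. \<phi> a = \<psi> a + q'"
      by blast
    interpret l: Vector_Spaces.linear scale scale' \<psi> by (rule lin)
    show ?affine
      by (simp add: affine_map_def lie_affgebra_of_def \<phi> l.add l.diff l.scale
          V'.scale_right_distrib V'.scale_left_diff_distrib)
  qed
qed

lemma linear_plus_const_preserves_aff_bracket_iff:
  fixes scale :: "'f::field \<Rightarrow> 'a::ab_group_add \<Rightarrow> 'a"
    and scale' :: "'f \<Rightarrow> 'b::ab_group_add \<Rightarrow> 'b"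
    and bracket :: "'a \<Rightarrow> 'a \<Rightarrow> 'a" and bracket' :: "'b \<Rightarrow> 'b \<Rightarrow> 'b"
  assumes "lie_affgebra_data scale bracket \<kappa> \<Lambda>"
    and "lie_affgebra_data scale' bracket' \<kappa>' \<Lambda>'"
    and "Vector_Spaces.linear scale scale' \<psi>"
  shows "(\<forall>a b. \<psi> (aff_bracket (lie_affgebra_of scale bracket \<kappa> \<Lambda> s) a b) + q' =
            aff_bracket (lie_affgebra_of scale' bracket' \<kappa>' \<Lambda>' s') (\<psi> a + q') (\<psi> b + q')) \<longleftrightarrow>
         (\<forall>a b. \<psi> (bracket a b) = bracket' (\<psi> a) (\<psi> b)) \<and>
         \<psi> \<circ> \<kappa> = \<kappa>' \<circ> \<psi> \<and>
         \<psi> \<circ> \<Lambda> = (\<lambda>x. ad bracket' q' x + \<Lambda>' x) \<circ> \<psi> \<and>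
         \<psi> s = s' - q' + \<kappa>' q'"
    (is "?preserves \<longleftrightarrow> ?conditions")
proof -
  interpret A: lie_affgebra_data scale bracket \<kappa> \<Lambda> by fact
  interpret B: lie_affgebra_data scale' bracket' \<kappa>' \<Lambda>' by fact
  interpret p: Vector_Spaces.linear scale scale' \<psi> by fact
  interpret k: Vector_Spaces.linear scale scale \<kappa> by (rule A.linear_kappa)
  interpret l: Vector_Spaces.linear scale scale \<Lambda> by (rule A.linear_lambda)
  interpret k': Vector_Spaces.linear scale' scale' \<kappa>' by (rule B.linear_kappa)
  interpret l': Vector_Spaces.linear scale' scale' \<Lambda>' by (rule B.linear_lambda)
  interpret L: Vector_Spaces.linear scale scale "\<lambda>x. bracket x u" for u
    by (rule A.linear_bracket_left)
  interpret L': Vector_Spaces.linear scale' scale' "\<lambda>x. bracket' x u" for u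
    by (rule B.linear_bracket_left)
  interpret R': Vector_Spaces.linear scale' scale' "\<lambda>x. bracket' u x" for u
    by (rule B.linear_bracket_right)
  have preserves_iff: "?preserves \<longleftrightarrow>
      (\<forall>a b. \<psi> (bracket a b) + \<psi> (\<kappa> a) + \<psi> (\<Lambda> (b - a)) + (\<psi> s + q') =
        bracket' (\<psi> a) (\<psi> b) + \<kappa>' (\<psi> a)
        + (ad bracket' q' (\<psi> (b - a)) + \<Lambda>' (\<psi> (b - a))) + (s' + \<kappa>' q'))"
    unfolding B.aff_bracket_translate
    by (simp add: lie_affgebra_of_def p.add p.diff add.assoc)
  show ?thesis
  proof
    assume ?preserves
    then have eq: "\<psi> (bracket a b) + \<psi> (\<kappa> a) + \<psi> (\<Lambda> (b - a)) + (\<psi> s + q') =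
        bracket' (\<psi> a) (\<psi> b) + \<kappa>' (\<psi> a)
        + (ad bracket' q' (\<psi> (b - a)) + \<Lambda>' (\<psi> (b - a))) + (s' + \<kappa>' q')" for a b
      unfolding preserves_iff by blast
    have const: "\<psi> s + q' = s' + \<kappa>' q'"
      using eq[of 0 0] by (simp add: ad_def A.bracket_self k.zero l.zero p.zero
          B.bracket_self k'.zero l'.zero R'.zero)
    have kappa: "\<psi> (\<kappa> a) = \<kappa>' (\<psi> a)" for a
      using eq[of a a] by (simp add: const ad_def A.bracket_self l.zero p.zero
          B.bracket_self l'.zero R'.zero)
    have lambda: "\<psi> (\<Lambda> b) = ad bracket' q' (\<psi> b) + \<Lambda>' (\<psi> b)" for b
      using eq[of 0 b] by (simp add: const L.zero k.zero p.zero L'.zero k'.zero)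
    have "\<psi> (bracket a b) = bracket' (\<psi> a) (\<psi> b)" for a b
      using eq[of a b] by (simp add: const kappa lambda)
    moreover have "\<psi> s = s' - q' + \<kappa>' q'"
      using const by (simp add: algebra_simps)
    ultimately show ?conditions
      by (simp add: kappa lambda fun_eq_iff)
  next
    assume ?conditions
    then show ?preserves
      unfolding preserves_iff by (simp add: fun_eq_iff)
  qed
qed

theorem theorem3p4:
  fixes scale :: "'f::field \<Rightarrow> 'a::ab_group_add \<Rightarrow> 'a"
    and scale' :: "'f \<Rightarrow> 'b::ab_group_add \<Rightarrow> 'b"
    and bracket :: "'a \<Rightarrow> 'a \<Rightarrow> 'a" and bracket' :: "'b \<Rightarrow> 'b \<Rightarrow> 'b"
    and \<kappa> \<Lambda> :: "'a \<Rightarrow> 'a" and \<kappa>' \<Lambda>' :: "'b \<Rightarrow> 'b"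
    and s :: 'a and s' :: 'b
    and \<phi> :: "'a \<Rightarrow> 'b"
  assumes "CHAR('f) \<noteq> 2"
    and "lie_affgebra_data scale bracket \<kappa> \<Lambda>"
    and "lie_affgebra_data scale' bracket' \<kappa>' \<Lambda>'"
  shows "lie_affgebra_hom (lie_affgebra_of scale bracket \<kappa> \<Lambda> s)
           (lie_affgebra_of scale' bracket' \<kappa>' \<Lambda>' s') \<phi> \<longleftrightarrow>
         (\<exists>\<psi> q'. lie_algebra_hom scale bracket scale' bracket' \<psi> \<and>
            (\<forall>a. \<phi> a = \<psi> a + q') \<and>
            \<psi> \<circ> \<kappa> = \<kappa>' \<circ> \<psi> \<and>
            \<psi> \<circ> \<Lambda> = (\<lambda>x. ad bracket' q' x + \<Lambda>' x) \<circ> \<psi> \<and>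
            \<psi> s = s' - q' + \<kappa>' q')"
proof -
  interpret A: lie_affgebra_data scale bracket \<kappa> \<Lambda> by fact
  interpret B: lie_affgebra_data scale' bracket' \<kappa>' \<Lambda>' by fact
  let ?A = "lie_affgebra_of scale bracket \<kappa> \<Lambda> s"
  let ?B = "lie_affgebra_of scale' bracket' \<kappa>' \<Lambda>' s'"
  have "lie_affgebra_hom ?A ?B \<phi> \<longleftrightarrow>
      (\<exists>\<psi> q'. Vector_Spaces.linear scale scale' \<psi> \<and> (\<forall>a. \<phi> a = \<psi> a + q') \<and>
        (\<forall>a b. \<psi> (aff_bracket ?A a b) + q' = aff_bracket ?B (\<psi> a + q') (\<psi> b + q')))"
    unfolding lie_affgebra_hom_def
      affine_map_iff_linear_plus_const[OF A.vector_space_axioms B.vector_space_axioms]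
    by (auto; metis)
  also have "\<dots> \<longleftrightarrow> (\<exists>\<psi> q'. lie_algebra_hom scale bracket scale' bracket' \<psi> \<and>
            (\<forall>a. \<phi> a = \<psi> a + q') \<and>
            \<psi> \<circ> \<kappa> = \<kappa>' \<circ> \<psi> \<and>
            \<psi> \<circ> \<Lambda> = (\<lambda>x. ad bracket' q' x + \<Lambda>' x) \<circ> \<psi> \<and>
            \<psi> s = s' - q' + \<kappa>' q')"
    unfolding lie_algebra_hom_def
    using linear_plus_const_preserves_aff_bracket_iff[OF assms(2,3)] by blast
  finally show ?thesis .
qed

end
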